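(* Consider the $g$-partial gathering problem for $k$ mobile agents in synchronous 1-interval connected (dynamic) bidirectional rings of $n$ nodes, in the model described in the context. Any algorithm solving this problem requires $\Omega(n)$ rounds in the worst case; that is, a lower bound on the time complexity of the $g$-partial gathering problem in dynamic rings is $\Omega(n)$.
   Context: Model. A dynamic bidirectional ring has anonymous nodes $v_0,\dots,v_{n-1}$ and links $e_i=\{v_i,v_{i+1 \bmod n}\}$; in each round an adversary may make at most one link missing (1-interval connectivity). Each node has a whiteboard that agents located there can read and write. There are $k\le n$ agents, which are deterministic finite automata with distinct IDs, knowledge of $n$ and $k$, and chirality (a common notion of forward $v_i\to v_{i+1}$ and backward $v_i\to v_{i-1}$). Agents cannot directly detect other agents at their node. Initially agents occupy pairwise distinct nodes, and a node's whiteboard is initially in one of two special states according to whether an agent starts there. Execution is fully synchronous: in each round every agent atomically reads the whiteboard, changes state, writes the whiteboard, and either stays or tries to move to a neighbouring node; if the link it tries to traverse is missing in that round it is blocked and stays. An agent terminates by entering a final state, after which it never acts. Problem. For a given positive integer $g<k$, an algorithm solves the $g$-partial gathering problem if every execution is finite (all agents terminate) and in the final configuration every node hosting at least one agent hosts at least $g$ agents. Time complexity is the number of rounds until the problem is solved.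
   Formalization: The lower bound is stated for g ≥ 2 only; for g = 1 every configuration is already partially gathered, so agents that terminate at once solve the problem in one round and the Ω(n) bound fails. *)

theory Defs
  imports Complex_Main "HOL-Library.Extended_Real"
begin

datatype move = Forward | Stay | Backward

text \<open>
  The agent with identifier \<open>i\<close> is the automaton with transition function \<open>delta A i\<close>, mapping the
  current state and the contents of the whiteboard to the next state, the new contents and the
  attempted move.  The ring size and the number of agents are known to the agents, so an algorithm
  is an object for one fixed pair \<open>n\<close>, \<open>k\<close>.
\<close>

record ('s, 'w) algorithm =
  delta :: "nat \<Rightarrow> 's \<Rightarrow> 'w \<Rightarrow> 's \<times> 'w \<times> move"
  s_init :: 's
  s_final :: 's
  w_empty :: 'w
  w_home :: 'w

text \<open>
  Identifiers are arbitrary natural numbers.  A whiteboard has to be able to hold identifiers, so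
  finiteness is required of the states and contents used by any finite collection of agents, not
  uniformly over all potential identifiers (which would make almost all agents indistinguishable).
\<close>

definition finite_automata :: "('s, 'w) algorithm \<Rightarrow> bool" where
  "finite_automata A \<longleftrightarrow>
     s_init A \<noteq> s_final A \<and> w_empty A \<noteq> w_home A \<and>
     (\<forall>I. finite I \<longrightarrow>
       (\<exists>S W. finite S \<and> finite W \<and> {s_init A, s_final A} \<subseteq> S \<and> {w_empty A, w_home A} \<subseteq> W \<and>
         (\<forall>i\<in>I. \<forall>s\<in>S. \<forall>w\<in>W. delta A i s w \<in> S \<times> W \<times> UNIV)))"

text \<open>
  Nodes are \<open>0, \<dots>, n - 1\<close> and agents are \<open>0, \<dots>, k - 1\<close>; agents only have access to their
  identifiers, never to these indices.
\<close>

record ('s, 'w) config =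
  pos :: "nat \<Rightarrow> nat"
  st :: "nat \<Rightarrow> 's"
  wb :: "nat \<Rightarrow> 'w"

text \<open>Link \<open>e\<close> joins the nodes \<open>e\<close> and \<open>(e + 1) mod n\<close>; \<open>None\<close> means that no link is missing.\<close>

fun destination :: "nat \<Rightarrow> nat option \<Rightarrow> move \<Rightarrow> nat \<Rightarrow> nat" where
  "destination n missing Stay v = v"
| "destination n missing Forward v = (if missing = Some v then v else (v + 1) mod n)"
| "destination n missing Backward v =
     (let u = (v + n - 1) mod n in if missing = Some u then v else u)"

definition act ::
  "nat \<Rightarrow> ('s, 'w) algorithm \<Rightarrow> (nat \<Rightarrow> nat) \<Rightarrow> nat option \<Rightarrow> nat \<Rightarrow>
     ('s, 'w) config \<Rightarrow> ('s, 'w) config" where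
  "act n A ids missing a C =
     (if st C a = s_final A then C
      else case delta A (ids a) (st C a) (wb C (pos C a)) of (s, w, d) \<Rightarrow>
        \<lparr>pos = (pos C)(a := destination n missing d (pos C a)),
         st = (st C)(a := s),
         wb = (wb C)(pos C a := w)\<rparr>)"

text \<open>
  A schedule gives, for each round, the missing link and the order in which agents sharing a node
  perform their atomic operations.  Since every agent acts once per round, at the node where it was
  at the beginning of the round, the relative order of agents at different nodes is immaterial.
\<close>

type_synonym schedule = "nat \<Rightarrow> nat option \<times> nat list"

definition valid_schedule :: "nat \<Rightarrow> nat \<Rightarrow> schedule \<Rightarrow> bool" where
  "valid_schedule n k \<sigma> \<longleftrightarrow>
     (\<forall>t. (\<forall>e. fst (\<sigma> t) = Some e \<longrightarrow> e < n) \<and>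
          distinct (snd (\<sigma> t)) \<and> set (snd (\<sigma> t)) = {..<k})"

definition init_config :: "nat \<Rightarrow> ('s, 'w) algorithm \<Rightarrow> (nat \<Rightarrow> nat) \<Rightarrow> ('s, 'w) config" where
  "init_config k A start =
     \<lparr>pos = start,
      st = (\<lambda>a. s_init A),
      wb = (\<lambda>v. if v \<in> start ` {..<k} then w_home A else w_empty A)\<rparr>"

primrec config_at ::
  "nat \<Rightarrow> nat \<Rightarrow> ('s, 'w) algorithm \<Rightarrow> (nat \<Rightarrow> nat) \<Rightarrow> (nat \<Rightarrow> nat) \<Rightarrow> schedule \<Rightarrow> nat \<Rightarrow>
     ('s, 'w) config" where
  "config_at n k A start ids \<sigma> 0 = init_config k A start"
| "config_at n k A start ids \<sigma> (Suc t) =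
     fold (act n A ids (fst (\<sigma> t))) (snd (\<sigma> t)) (config_at n k A start ids \<sigma> t)"

definition scenarios :: "nat \<Rightarrow> nat \<Rightarrow> ((nat \<Rightarrow> nat) \<times> (nat \<Rightarrow> nat) \<times> schedule) set" where
  "scenarios n k =
     {(start, ids, \<sigma>).
        start ` {..<k} \<subseteq> {..<n} \<and> inj_on start {..<k} \<and> inj_on ids {..<k} \<and> valid_schedule n k \<sigma>}"

definition all_terminated :: "nat \<Rightarrow> ('s, 'w) algorithm \<Rightarrow> ('s, 'w) config \<Rightarrow> bool" where
  "all_terminated k A C \<longleftrightarrow> (\<forall>a<k. st C a = s_final A)"

definition partially_gathered :: "nat \<Rightarrow> nat \<Rightarrow> nat \<Rightarrow> ('s, 'w) config \<Rightarrow> bool" where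
  "partially_gathered g n k C \<longleftrightarrow>
     (\<forall>v<n. (\<exists>a<k. pos C a = v) \<longrightarrow> g \<le> card {a. a < k \<and> pos C a = v})"

definition solves_partial_gathering :: "nat \<Rightarrow> nat \<Rightarrow> nat \<Rightarrow> ('s, 'w) algorithm \<Rightarrow> bool" where
  "solves_partial_gathering g n k A \<longleftrightarrow>
     (\<forall>(start, ids, \<sigma>) \<in> scenarios n k.
        \<exists>t. all_terminated k A (config_at n k A start ids \<sigma> t) \<and>
            partially_gathered g n k (config_at n k A start ids \<sigma> t))"

text \<open>Once all agents have terminated the configuration does not change any more.\<close>

definition rounds ::
  "nat \<Rightarrow> nat \<Rightarrow> ('s, 'w) algorithm \<Rightarrow> (nat \<Rightarrow> nat) \<Rightarrow> (nat \<Rightarrow> nat) \<Rightarrow> schedule \<Rightarrow> nat" where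
  "rounds n k A start ids \<sigma> = (LEAST t. all_terminated k A (config_at n k A start ids \<sigma> t))"

definition time_complexity :: "nat \<Rightarrow> nat \<Rightarrow> ('s, 'w) algorithm \<Rightarrow> enat" where
  "time_complexity n k A = (SUP (start, ids, \<sigma>) \<in> scenarios n k. enat (rounds n k A start ids \<sigma>))"

end

theory Submission
  imports Defs "HOL-Library.Ramsey" "HOL-Library.FuncSet"
begin

text \<open>
  No missing link is needed for the lower bound. Let \<open>T\<close> be the running time.

  If \<open>2 k \<le> n\<close>, one agent starts at distance at least \<open>n / 4\<close> from all others, and it cannot
  share its final node with another agent unless \<open>2 T \<ge> n / 4\<close>.

  If \<open>2 k > n\<close>, the agents start at the nodes \<open>0, \<dots>, k - 1\<close>. Since identifiers are arbitrary
  naturals, Ramsey's theorem yields an infinite set of identifiers on which the final positions do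
  not depend on the \<open>k\<close> identifiers chosen, as long as they increase along the ring. Comparing the
  runs with identifiers \<open>h 0, \<dots>, h (k - 1)\<close> and \<open>h 1, \<dots>, h k\<close>, which near the middle agree up to
  a shift by one node because information travels one node per round, shows that agents far from
  both ends are all displaced by the same amount. So they end at distinct nodes.
\<close>

section \<open>Displacement of an agent over time\<close>

lemma act_other [simp]:
  assumes "b \<noteq> a"
  shows "pos (act n A ids m a C) b = pos C b" "st (act n A ids m a C) b = st C b"
  using assms by (auto simp: act_def split: prod.splits)

lemma wb_act_other [simp]:
  assumes "v \<noteq> pos C a"
  shows "wb (act n A ids m a C) v = wb C v"
  using assms by (auto simp: act_def split: prod.splits)

lemma fold_act_other [simp]:
  assumes "b \<notin> set xs"
  shows "pos (fold (act n A ids m) xs C) b = pos C b" "st (fold (act n A ids m) xs C) b = st C b"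
  using assms by (induction xs arbitrary: C) auto

lemma pos_act: "\<exists>d. pos (act n A ids m a C) a = destination n m d (pos C a)"
proof (cases "st C a = s_final A")
  case True
  then show ?thesis by (intro exI[of _ Stay]) (simp add: act_def)
qed (auto simp: act_def split: prod.splits)

text \<open>An order without repetitions lets each agent act at most once, so a whole round amounts
  to a single \<open>destination\<close>; \<open>Stay\<close> covers an agent absent from
  \<open>xs\<close>.\<close>

lemma pos_fold_act:
  assumes "distinct xs"
  shows "\<exists>d. pos (fold (act n A ids m) xs C) a = destination n m d (pos C a)"
  using assms
proof (induction xs arbitrary: C)
  case Nil
  show ?case by (intro exI[of _ Stay]) simp
next
  case (Cons b xs)
  show ?case
  proof (cases "a = b")
    case True
    then show ?thesis using Cons.prems pos_act by simp
  next
    case False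
    then show ?thesis using Cons.IH[of "act n A ids m b C"] Cons.prems by simp
  qed
qed

lemma destination_offset:
  assumes "v < n"
  shows "\<exists>d. \<bar>d\<bar> \<le> 1 \<and> int (destination n m mv v) = (int v + d) mod int n"
proof -
  have "int ((v + n - 1) mod n) = (int v - 1 + int n) mod int n"
    using assms by (simp add: zmod_int of_nat_diff algebra_simps)
  then have b: "int ((v + n - 1) mod n) = (int v + (-1)) mod int n" by simp
  have f: "int ((v + 1) mod n) = (int v + 1) mod int n"
    by (simp add: zmod_int algebra_simps)
  have s: "int v = (int v + 0) mod int n" using assms by simp
  have "int (destination n m mv v) \<in> (\<lambda>d. (int v + d) mod int n) ` {-1, 0, 1}"
    using b f s by (cases mv) (auto simp: Let_def)
  then obtain d where "d \<in> {-1, 0, 1}" "int (destination n m mv v) = (int v + d) mod int n"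
    by blast
  then show ?thesis by (intro exI[of _ d]) auto
qed

text \<open>The displacement \<open>d\<close> is a signed integer, reduced modulo \<open>n\<close>
  only at the end, so that single moves add up and final positions can be compared as
  congruences.\<close>

lemma pos_config_at_offset:
  assumes "valid_schedule n k \<sigma>" "start a < n"
  shows "\<exists>d. \<bar>d\<bar> \<le> int t \<and>
    int (pos (config_at n k A start ids \<sigma> t) a) = (int (start a) + d) mod int n"
proof (induction t)
  case 0
  show ?case using assms by (intro exI[of _ 0]) (simp add: init_config_def)
next
  case (Suc t)
  let ?C = "config_at n k A start ids \<sigma> t"
  obtain d where d: "\<bar>d\<bar> \<le> int t" "int (pos ?C a) = (int (start a) + d) mod int n"
    using Suc by blast
  have "int (pos ?C a) < int n" using d(2) assms(2) by simp
  then have lt: "pos ?C a < n" by simp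
  have "distinct (snd (\<sigma> t))" using assms by (simp add: valid_schedule_def)
  then obtain mv where
    mv: "pos (config_at n k A start ids \<sigma> (Suc t)) a = destination n (fst (\<sigma> t)) mv (pos ?C a)"
    using pos_fold_act by fastforce
  obtain e where e: "\<bar>e\<bar> \<le> 1"
    "int (destination n (fst (\<sigma> t)) mv (pos ?C a)) = (int (pos ?C a) + e) mod int n"
    using destination_offset[OF lt] by blast
  show ?case using d e mv by (intro exI[of _ "d + e"]) (simp add: mod_simps algebra_simps)
qed

section \<open>Final configurations and the running time\<close>

lemma config_at_terminated:
  assumes "valid_schedule n k \<sigma>" "all_terminated k A (config_at n k A start ids \<sigma> t)" "t \<le> u"
  shows "config_at n k A start ids \<sigma> u = config_at n k A start ids \<sigma> t"
  using assms(3)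
proof (induction u rule: dec_induct)
  case (step u)
  have "fold (act n A ids m) xs C = C" if "all_terminated k A C" "set xs \<subseteq> {..<k}" for xs C m
    using that by (induction xs) (auto simp: act_def all_terminated_def)
  then show ?case using step assms by (auto simp: valid_schedule_def)
qed simp

text \<open>\<open>T\<close> bounds the running time of every scenario and a terminated
  configuration is frozen, so all final configurations can be inspected at the same round
  \<open>T\<close>.\<close>

lemma gathered_at_time_complexity:
  assumes "solves_partial_gathering g n k A" "time_complexity n k A = enat T"
    and scen: "(start, ids, \<sigma>) \<in> scenarios n k"
  shows "partially_gathered g n k (config_at n k A start ids \<sigma> T)"
proof -
  let ?C = "config_at n k A start ids \<sigma>"
  obtain t where t: "all_terminated k A (?C t)" "partially_gathered g n k (?C t)"
    using assms(1) scen by (fastforce simp: solves_partial_gathering_def)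
  have v: "valid_schedule n k \<sigma>" using scen by (simp add: scenarios_def)
  let ?r = "rounds n k A start ids \<sigma>"
  have "enat ?r \<le> enat T"
    unfolding assms(2)[symmetric] time_complexity_def using scen by (rule SUP_upper2) simp
  then have "?r \<le> T" by simp
  moreover have "all_terminated k A (?C ?r)" "?r \<le> t"
    unfolding rounds_def using t(1) by (rule LeastI) (rule Least_le, rule t(1))
  ultimately have "?C T = ?C t" using config_at_terminated[OF v] by metis
  then show ?thesis using t(2) by simp
qed

lemma partially_gathered_meets:
  assumes "partially_gathered g n k C" "1 < g" "a < k" "pos C a < n"
  shows "\<exists>b<k. b \<noteq> a \<and> pos C b = pos C a"
proof (rule ccontr)
  assume "\<not> ?thesis"
  then have "{b. b < k \<and> pos C b = pos C a} = {a}" using assms(3) by auto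
  moreover have "g \<le> card {b. b < k \<and> pos C b = pos C a}"
    using assms unfolding partially_gathered_def by blast
  ultimately show False using assms(2) by simp
qed

section \<open>Few agents: one isolated agent\<close>

lemma time_bound_few_agents:
  assumes "solves_partial_gathering g n k A" "time_complexity n k A = enat T"
    and "1 < g" "g < k" "2 * k \<le> n"
  shows "n \<le> 8 * T"
proof (rule ccontr)
  assume T: "\<not> n \<le> 8 * T"
  \<comment> \<open>Agents \<open>1, ..., k - 1\<close> start at the nodes of their indices, so
    \<open>p\<close> is about the middle of the free arc; as \<open>2 k \<le> n\<close>, it is at
    least \<open>n / 4\<close> away from them on both sides.\<close>
  define p where "p = (n + k) div 2"
  define start where "start = (\<lambda>a::nat. if a = 0 then p else a)"
  define \<sigma> :: schedule where "\<sigma> = (\<lambda>t. (None, [0..<k]))"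
  have pn: "k \<le> p" "p < n" using assms by (auto simp: p_def)
  have v: "valid_schedule n k \<sigma>" by (auto simp: \<sigma>_def valid_schedule_def)
  have "start ` {..<k} \<subseteq> {..<n}" "inj_on start {..<k}"
    using pn assms by (auto simp: start_def inj_on_def)
  then have s: "(start, id, \<sigma>) \<in> scenarios n k" using v by (simp add: scenarios_def)
  let ?C = "config_at n k A start id \<sigma> T"
  have offset: "\<exists>d. \<bar>d\<bar> \<le> int T \<and> int (pos ?C a) = (int (start a) + d) mod int n" if "a < k" for a
    using that pn by (intro pos_config_at_offset[OF v]) (auto simp: start_def)
  obtain d where d: "\<bar>d\<bar> \<le> int T" "int (pos ?C 0) = (int p + d) mod int n"
    using offset[of 0] assms by (auto simp: start_def)
  have "int (pos ?C 0) < int n" using d(2) pn by simp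
  then obtain b where b: "b < k" "b \<noteq> 0" "pos ?C b = pos ?C 0"
    using partially_gathered_meets[OF gathered_at_time_complexity[OF assms(1,2) s]] assms by force
  obtain e where e: "\<bar>e\<bar> \<le> int T" "int (pos ?C b) = (int b + e) mod int n"
    using offset[OF b(1)] b by (auto simp: start_def)
  have "int n dvd (int p + d) - (int b + e)" using d e b by (metis mod_eq_dvd_iff)
  \<comment> \<open>The two offsets contribute at most \<open>2 T < n / 4\<close>, so the difference
    stays strictly within one period.\<close>
  moreover have "0 < (int p + d) - (int b + e)" "(int p + d) - (int b + e) < int n"
    using d e b T assms by (auto simp: p_def)
  ultimately show False using zdvd_not_zless by blast
qed

section \<open>Shifting a run by one node\<close>

text \<open>
  On the nodes in \<open>I\<close>, the second configuration is the first one moved back by one node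
  and by one agent index; agents without a counterpart, namely agent \<open>0\<close> of the first and
  agent \<open>k - 1\<close> of the second configuration, are elsewhere.
\<close>

definition shifted_on :: "nat \<Rightarrow> nat set \<Rightarrow> ('s, 'w) config \<Rightarrow> ('s, 'w) config \<Rightarrow> bool" where
  "shifted_on k I C D \<longleftrightarrow>
     (\<forall>v\<in>I. wb C (Suc v) = wb D v) \<and>
     (\<forall>j<k - 1. pos D j \<in> I \<or> pos C (Suc j) \<in> Suc ` I \<longrightarrow>
        pos C (Suc j) = Suc (pos D j) \<and> st C (Suc j) = st D j) \<and>
     pos C 0 \<notin> Suc ` I \<and> pos D (k - 1) \<notin> I"

lemma destination_Suc:
  assumes "1 \<le> v" "Suc (Suc v) < n"
  shows "destination n None d (Suc v) = Suc (destination n None d v)"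
proof -
  have "(v + n - 1) mod n = v - 1"
    using assms mod_add_self2[of "v - 1" n] by simp
  moreover have "(Suc v + n - 1) mod n = v" using assms by simp
  ultimately show ?thesis using assms by (cases d) (auto simp: Let_def)
qed

text \<open>The speed limit read backwards: an agent found in a window after a round was in the
  window enlarged by one node before it.\<close>

lemma destination_neighbour:
  assumes "1 \<le> w" "Suc w < n" "destination n None d v = w" "v < n"
  shows "v \<in> {w - 1, w, w + 1}"
proof -
  have "(v + n - 1) mod n = (if v = 0 then n - 1 else v - 1)"
    using assms(4) mod_add_self2[of "v - 1" n] by (cases v) auto
  moreover have "(v + 1) mod n = (if v + 1 = n then 0 else v + 1)"
    using assms(4) by auto
  ultimately show ?thesis using assms by (cases d) (auto simp: Let_def split: if_splits)
qed

text \<open>Corresponding agents in the window read equal whiteboards, hence write and move alike;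
  agents outside it leave its whiteboards alone. The premises on positions refer to the start of the
  fold, since every agent acts only once, from the node where the round began.\<close>

lemma fold_act_shifted:
  assumes I: "I \<subseteq> {1..<n - 2}"
    and "distinct xs" "\<forall>j\<in>set xs. ids (Suc j) = ids' j"
    and "\<forall>v\<in>I. wb C (Suc v) = wb D v"
    and "\<forall>j\<in>set xs. pos D j \<in> I \<or> pos C (Suc j) \<in> Suc ` I \<longrightarrow>
        pos C (Suc j) = Suc (pos D j) \<and> st C (Suc j) = st D j"
  shows "(\<forall>v\<in>I. wb (fold (act n A ids None) (map Suc xs) C) (Suc v) =
            wb (fold (act n A ids' None) xs D) v) \<and>
    (\<forall>j\<in>set xs. pos D j \<in> I \<or> pos C (Suc j) \<in> Suc ` I \<longrightarrow>
        pos (fold (act n A ids None) (map Suc xs) C) (Suc j) =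
          Suc (pos (fold (act n A ids' None) xs D) j) \<and>
        st (fold (act n A ids None) (map Suc xs) C) (Suc j) =
          st (fold (act n A ids' None) xs D) j)"
  using assms(2-)
proof (induction xs arbitrary: C D)
  case Nil
  then show ?case by simp
next
  case (Cons j xs)
  let ?C = "act n A ids None (Suc j) C" and ?D = "act n A ids' None j D"
  have same: "pos ?C (Suc i) = pos C (Suc i)" "st ?C (Suc i) = st C (Suc i)"
    "pos ?D i = pos D i" "st ?D i = st D i" if "i \<in> set xs" for i
    using that Cons.prems(1) by (auto intro!: act_other)
  have step: "(\<forall>v\<in>I. wb ?C (Suc v) = wb ?D v) \<and>
    (pos D j \<in> I \<or> pos C (Suc j) \<in> Suc ` I \<longrightarrow>
       pos ?C (Suc j) = Suc (pos ?D j) \<and> st ?C (Suc j) = st ?D j)"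
  proof (cases "pos D j \<in> I \<or> pos C (Suc j) \<in> Suc ` I")
    case True
    then have eq: "pos C (Suc j) = Suc (pos D j)" "st C (Suc j) = st D j" and inI: "pos D j \<in> I"
      using Cons.prems(4) by auto
    have "pos D j \<in> {1..<n - 2}" using inI I by blast
    then have "1 \<le> pos D j" "Suc (Suc (pos D j)) < n" by auto
    then have "destination n None d (Suc (pos D j)) = Suc (destination n None d (pos D j))" for d
      by (rule destination_Suc)
    then show ?thesis
      using eq inI Cons.prems(2,3) by (auto simp: act_def split: prod.splits)
  next
    case False
    \<comment> \<open>Neither of the two agents stands on a window node, so their writes miss the
      window.\<close>
    then have "wb ?C (Suc v) = wb ?D v" if "v \<in> I" for v
      using that Cons.prems(3) wb_act_other by (metis imageI)
    then show ?thesis using False by simp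
  qed
  have IH: "(\<forall>v\<in>I. wb (fold (act n A ids None) (map Suc xs) ?C) (Suc v) =
            wb (fold (act n A ids' None) xs ?D) v) \<and>
    (\<forall>j\<in>set xs. pos ?D j \<in> I \<or> pos ?C (Suc j) \<in> Suc ` I \<longrightarrow>
        pos (fold (act n A ids None) (map Suc xs) ?C) (Suc j) =
          Suc (pos (fold (act n A ids' None) xs ?D) j) \<and>
        st (fold (act n A ids None) (map Suc xs) ?C) (Suc j) =
          st (fold (act n A ids' None) xs ?D) j)"
  proof (rule Cons.IH)
    show "distinct xs" "\<forall>i\<in>set xs. ids (Suc i) = ids' i" using Cons.prems(1,2) by auto
    show "\<forall>v\<in>I. wb ?C (Suc v) = wb ?D v" using step by blast
    show "\<forall>i\<in>set xs. pos ?D i \<in> I \<or> pos ?C (Suc i) \<in> Suc ` I \<longrightarrow>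
        pos ?C (Suc i) = Suc (pos ?D i) \<and> st ?C (Suc i) = st ?D i"
    proof
      fix i assume i: "i \<in> set xs"
      then have "i \<in> set (j # xs)" by simp
      from Cons.prems(4)[rule_format, OF this]
      show "pos ?D i \<in> I \<or> pos ?C (Suc i) \<in> Suc ` I \<longrightarrow>
        pos ?C (Suc i) = Suc (pos ?D i) \<and> st ?C (Suc i) = st ?D i"
        unfolding same[OF i] by blast
    qed
  qed
  have "j \<notin> set xs" "Suc j \<notin> set (map Suc xs)" using Cons.prems(1) by auto
  note last = fold_act_other[OF this(1)] fold_act_other[OF this(2)]
  show ?case
    unfolding list.map fold_simps
  proof (intro conjI ballI)
    fix i assume "i \<in> set (j # xs)"
    then consider "i = j" | "i \<in> set xs" by auto
    then show "pos D i \<in> I \<or> pos C (Suc i) \<in> Suc ` I \<longrightarrow>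
        pos (fold (act n A ids None) (map Suc xs) ?C) (Suc i) =
          Suc (pos (fold (act n A ids' None) xs ?D) i) \<and>
        st (fold (act n A ids None) (map Suc xs) ?C) (Suc i) =
          st (fold (act n A ids' None) xs ?D) i"
    proof cases
      case 1
      then show ?thesis unfolding last 1 using step by blast
    next
      case 2
      from IH[THEN conjunct2, rule_format, OF 2] show ?thesis unfolding same[OF 2] by blast
    qed
  qed (use IH in blast)
qed

text \<open>Within one round, outside agents get at most one node deep into the window, so giving up
  one node at each end restores the relation. The bounds on \<open>a\<close> and \<open>b\<close>
  exclude wrap-around.\<close>

lemma round_shifted:
  assumes sh: "shifted_on k {a..b} C D"
    and ids: "\<forall>j<k - 1. ids (Suc j) = ids' j"
    and ab: "1 \<le> a" "Suc (Suc b) < n" "1 < k"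
    and lt: "\<forall>j<k. pos C j < n \<and> pos D j < n"
  shows "shifted_on k {Suc a..b - 1}
    (fold (act n A ids None) [0..<k] C) (fold (act n A ids' None) [0..<k] D)"
    (is "shifted_on k ?J ?C ?D")
proof -
  let ?I = "{a..b}" and ?Cz = "act n A ids None 0 C" and ?xs = "[0..<k - 1]"
  let ?Ce = "fold (act n A ids None) (map Suc ?xs) ?Cz" and ?De = "fold (act n A ids' None) ?xs D"
  \<comment> \<open>Shifting indices aligns the two orders except for agent \<open>0\<close>, which
    acts first in \<open>C\<close>, and agent \<open>k - 1\<close>, which acts last in
    \<open>D\<close>. Both are outside the window, so these extra actions do not disturb it.\<close>
  have "[0..<k] = 0 # map Suc ?xs" using ab by (simp add: upt_conv_Cons map_Suc_upt)
  then have C: "?C = ?Ce" by (simp only: fold_simps)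
  have "[0..<k] = ?xs @ [k - 1]" using ab upt_Suc_append[of 0 "k - 1"] by simp
  then have D: "?D = act n A ids' None (k - 1) ?De" by simp
  have I: "?I \<subseteq> {1..<n - 2}" using ab by auto
  have wb0: "\<forall>v\<in>?I. wb ?Cz (Suc v) = wb D v"
    using sh unfolding shifted_on_def by (metis imageI wb_act_other)
  have Cz: "pos ?Cz (Suc j) = pos C (Suc j)" "st ?Cz (Suc j) = st C (Suc j)" for j by simp_all
  have main: "(\<forall>v\<in>?I. wb ?Ce (Suc v) = wb ?De v) \<and>
    (\<forall>j\<in>set ?xs. pos D j \<in> ?I \<or> pos ?Cz (Suc j) \<in> Suc ` ?I \<longrightarrow>
        pos ?Ce (Suc j) = Suc (pos ?De j) \<and> st ?Ce (Suc j) = st ?De j)"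
  proof (rule fold_act_shifted[OF I _ _ wb0])
    show "distinct ?xs" by simp
    show "\<forall>j\<in>set ?xs. ids (Suc j) = ids' j" using ids by simp
    show "\<forall>j\<in>set ?xs. pos D j \<in> ?I \<or> pos ?Cz (Suc j) \<in> Suc ` ?I \<longrightarrow>
        pos ?Cz (Suc j) = Suc (pos D j) \<and> st ?Cz (Suc j) = st D j"
      using sh unfolding shifted_on_def Cz set_upt by (meson atLeastLessThan_iff)
  qed
  have last: "pos ?De (k - 1) \<notin> ?I" using sh by (simp add: shifted_on_def)
  have wb: "\<forall>v\<in>?I. wb ?C (Suc v) = wb ?D v"
    unfolding C D using main last wb_act_other by metis
  have ag: "pos ?C (Suc j) = Suc (pos ?D j) \<and> st ?C (Suc j) = st ?D j"
    if "j < k - 1" "pos D j \<in> ?I \<or> pos C (Suc j) \<in> Suc ` ?I" for j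
    unfolding C D using main[THEN conjunct2, rule_format, of j, unfolded Cz] that by simp
  have backD: "pos D j \<in> ?I" if "j < k" "pos ?D j \<in> ?J" for j
  proof -
    obtain d where "pos ?D j = destination n None d (pos D j)"
      using pos_fold_act[of "[0..<k]"] by fastforce
    then have "pos D j \<in> {pos ?D j - 1, pos ?D j, pos ?D j + 1}"
      using that ab lt by (intro destination_neighbour[of _ n d]) auto
    then show ?thesis using that by auto
  qed
  have backC: "pos C j \<in> Suc ` ?I" if "j < k" "pos ?C j \<in> Suc ` ?J" for j
  proof -
    obtain d where "pos ?C j = destination n None d (pos C j)"
      using pos_fold_act[of "[0..<k]"] by fastforce
    then have "pos C j \<in> {pos ?C j - 1, pos ?C j, pos ?C j + 1}"
      using that ab lt by (intro destination_neighbour[of _ n d]) auto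
    then show ?thesis using that ab by (auto simp: image_Suc_atLeastAtMost)
  qed
  show ?thesis
    unfolding shifted_on_def
  proof (intro conjI allI impI)
    show "\<forall>v\<in>?J. wb ?C (Suc v) = wb ?D v" using wb by auto
  next
    fix j assume j: "j < k - 1" "pos ?D j \<in> ?J \<or> pos ?C (Suc j) \<in> Suc ` ?J"
    then have "j < k" "Suc j < k" by auto
    then have "pos D j \<in> ?I \<or> pos C (Suc j) \<in> Suc ` ?I" using backC backD j(2) by blast
    then show "pos ?C (Suc j) = Suc (pos ?D j)" "st ?C (Suc j) = st ?D j" using ag[OF j(1)] by blast+
  next
    have "0 < k" "k - 1 < k" using ab by auto
    then show "pos ?C 0 \<notin> Suc ` ?J" "pos ?D (k - 1) \<notin> ?J"
      using backC backD sh unfolding shifted_on_def by blast+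
  qed
qed

section \<open>Runs from a block of consecutive nodes\<close>

definition packed_run ::
  "nat \<Rightarrow> nat \<Rightarrow> ('s, 'w) algorithm \<Rightarrow> (nat \<Rightarrow> nat) \<Rightarrow> nat \<Rightarrow> ('s, 'w) config" where
  "packed_run n k A ids = config_at n k A (\<lambda>a. a) ids (\<lambda>t. (None, [0..<k]))"

lemma packed_run_offset:
  assumes "a < k" "k \<le> n"
  shows "\<exists>d. \<bar>d\<bar> \<le> int t \<and> int (pos (packed_run n k A ids t) a) = (int a + d) mod int n"
  unfolding packed_run_def using assms
  by (intro pos_config_at_offset) (auto simp: valid_schedule_def)

lemma pos_packed_run_less:
  assumes "a < k" "k \<le> n"
  shows "pos (packed_run n k A ids t) a < n"
proof -
  obtain d where "int (pos (packed_run n k A ids t) a) = (int a + d) mod int n"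
    using packed_run_offset[OF assms] by blast
  then have "int (pos (packed_run n k A ids t) a) < int n" using assms by simp
  then show ?thesis by simp
qed

lemma packed_run_interval:
  assumes "k \<le> n" "t \<le> a" "a + t < k"
  shows "a - t \<le> pos (packed_run n k A ids t) a" "pos (packed_run n k A ids t) a \<le> a + t"
proof -
  obtain d where d: "\<bar>d\<bar> \<le> int t" "int (pos (packed_run n k A ids t) a) = (int a + d) mod int n"
    using packed_run_offset[of a k n t A ids] assms by fastforce
  moreover have "(int a + d) mod int n = int a + d" using d assms by (intro mod_pos_pos_trivial) auto
  ultimately show "a - t \<le> pos (packed_run n k A ids t) a"
    "pos (packed_run n k A ids t) a \<le> a + t" using assms by auto
qed

text \<open>The initial window ends at \<open>k - 3\<close> so that \<open>round_shifted\<close>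
  applies even when \<open>k = n\<close>. Once the window is empty, the relation holds
  trivially.\<close>

lemma packed_run_shifted:
  assumes "\<forall>j<k - 1. ids (Suc j) = ids' j" "3 < k" "k \<le> n"
  shows "shifted_on k {1 + t..k - 3 - t} (packed_run n k A ids t) (packed_run n k A ids' t)"
proof (induction t)
  case 0
  show ?case using assms by (auto simp: shifted_on_def packed_run_def init_config_def)
next
  case (Suc t)
  have "shifted_on k {Suc (1 + t)..k - 3 - t - 1}
    (packed_run n k A ids (Suc t)) (packed_run n k A ids' (Suc t))"
    using round_shifted[OF Suc assms(1), of n A] assms pos_packed_run_less[of _ k n A]
    by (simp add: packed_run_def)
  then show ?case by simp
qed

text \<open>The margin \<open>2 * t\<close> consists of \<open>t\<close> nodes lost by the window
  and \<open>t\<close> nodes the agent may have travelled; the rest comes from the initial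
  window.\<close>

lemma pos_packed_run_Suc:
  assumes "\<forall>j<k - 1. ids (Suc j) = ids' j" "k \<le> n" "2 * t + 1 \<le> j" "j + 2 * t + 3 \<le> k"
  shows "pos (packed_run n k A ids t) (Suc j) = Suc (pos (packed_run n k A ids' t) j)"
proof -
  have "pos (packed_run n k A ids' t) j \<in> {1 + t..k - 3 - t}"
    using packed_run_interval[of k n t j A ids'] assms by auto
  moreover have "shifted_on k {1 + t..k - 3 - t} (packed_run n k A ids t) (packed_run n k A ids' t)"
    using assms by (intro packed_run_shifted) auto
  moreover have "j < k - 1" using assms(4) by simp
  ultimately show ?thesis unfolding shifted_on_def by blast
qed

section \<open>Identifiers that cannot be told apart\<close>

text \<open>Colour a \<open>k\<close>-set of identifiers by the positions at round \<open>t\<close>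
  when its elements are assigned in increasing order. There are finitely many colours;
  \<open>h\<close> enumerates an infinite homogeneous set, whose first \<open>k\<close> elements and
  the \<open>k\<close> elements from the second on get the same colour.\<close>

lemma homogeneous_identifiers:
  fixes A :: "('s, 'w) algorithm"
  assumes "k \<le> n"
  shows "\<exists>h :: nat \<Rightarrow> nat. strict_mono h \<and>
    (\<forall>a<k. pos (packed_run n k A h t) a = pos (packed_run n k A (\<lambda>i. h (Suc i)) t) a)"
proof -
  define F where "F = ({..<k} \<rightarrow>\<^sub>E {..<n})"
  define P where "P ids = restrict (pos (packed_run n k A ids t)) {..<k}" for ids
  define P' where "P' X = P (\<lambda>a. if a < k then sorted_list_of_set X ! a else 0)" for X
  have PF: "P ids \<in> F" for ids
    using assms pos_packed_run_less unfolding P_def F_def by fastforce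
  have "finite F" unfolding F_def by (intro finite_PiE) auto
  \<comment> \<open>Ramsey's theorem expects numbers as colours, so the position functions are
    numbered by \<open>c\<close>.\<close>
  then obtain c where c: "bij_betw c F {0..<card F}" using ex_bij_betw_finite_nat by blast
  have "\<forall>X. X \<subseteq> (UNIV :: nat set) \<and> finite X \<and> card X = k \<longrightarrow> (c \<circ> P') X < card F"
    using c PF unfolding P'_def bij_betw_def by force
  then obtain Y q where Y: "infinite Y"
    and q: "\<forall>X. X \<subseteq> Y \<and> finite X \<and> card X = k \<longrightarrow> (c \<circ> P') X = q"
    using Ramsey[of "UNIV :: nat set" k "c \<circ> P'" "card F"] by blast
  have P'_const: "P' X = P' Z"
    if "X \<subseteq> Y" "finite X" "card X = k" "Z \<subseteq> Y" "finite Z" "card Z = k" for X Z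
  proof -
    have "c (P' X) = c (P' Z)" using q that by simp
    moreover have "inj_on c F" using c by (simp add: bij_betw_def)
    ultimately show ?thesis using PF unfolding P'_def by (meson inj_onD)
  qed
  \<comment> \<open>A run consults only the identifiers of agents below \<open>k\<close>, so the
    default \<open>0\<close> in \<open>P'\<close> is harmless.\<close>
  have P_cong: "P ids = P ids'" if "\<And>a. a < k \<Longrightarrow> ids a = ids' a" for ids ids'
  proof -
    have fold: "fold (act n A ids m) xs C = fold (act n A ids' m) xs C" if "set xs \<subseteq> {..<k}" for m xs C
      using that \<open>\<And>a. a < k \<Longrightarrow> ids a = ids' a\<close>
      by (induction xs arbitrary: C) (auto simp: act_def)
    have "packed_run n k A ids u = packed_run n k A ids' u" for u
      by (induction u) (auto simp: packed_run_def intro!: fold)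
    then show ?thesis by (simp add: P_def)
  qed
  have P'_image: "P' (f ` {..<k}) = P f" if "strict_mono f" for f :: "nat \<Rightarrow> nat"
  proof -
    have "sorted (map f [0..<k])" "distinct (map f [0..<k])"
      using that by (auto simp: sorted_iff_nth_mono strict_mono_less_eq distinct_map
          strict_mono_imp_inj_on inj_on_def strict_mono_eq)
    then have "sorted_list_of_set (set (map f [0..<k])) = map f [0..<k]"
      by (rule sorted_list_of_set.idem_if_sorted_distinct)
    then have "sorted_list_of_set (f ` {..<k}) = map f [0..<k]" by (simp add: atLeast0LessThan)
    then show ?thesis unfolding P'_def by (intro P_cong) simp
  qed
  define h where "h = enumerate Y"
  have h: "strict_mono h" "range h \<subseteq> Y"
    using Y by (auto simp: h_def strict_mono_enumerate enumerate_in_set)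
  have h': "strict_mono (\<lambda>i. h (Suc i))" using h(1) by (simp add: strict_mono_def)
  have "card (f ` {..<k}) = k" if "strict_mono f" for f :: "nat \<Rightarrow> nat"
    using that by (simp add: card_image strict_mono_imp_inj_on)
  then have "P' (h ` {..<k}) = P' ((\<lambda>i. h (Suc i)) ` {..<k})"
    using h h' by (intro P'_const) auto
  then have eq: "P h = P (\<lambda>i. h (Suc i))" using P'_image h h' by simp
  have "pos (packed_run n k A h t) a = pos (packed_run n k A (\<lambda>i. h (Suc i)) t) a"
    if "a < k" for a
    using fun_cong[OF eq, of a] that by (simp add: P_def)
  then show ?thesis using h(1) by blast
qed

section \<open>Many agents: equal displacement in the middle\<close>

lemma time_bound_many_agents:
  assumes "solves_partial_gathering g n k A" "time_complexity n k A = enat T"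
    and "1 < g" "g < k" "k \<le> n"
  shows "k \<le> 8 * T + 5"
proof (rule ccontr)
  assume "\<not> ?thesis"
  then have kT: "8 * T + 5 < k" by simp
  obtain h :: "nat \<Rightarrow> nat" where h: "strict_mono h"
    "\<forall>a<k. pos (packed_run n k A h T) a = pos (packed_run n k A (\<lambda>i. h (Suc i)) T) a"
    using homogeneous_identifiers[OF assms(5)] by blast
  define p where "p = pos (packed_run n k A h T)"
  \<comment> \<open>By the choice of \<open>h\<close> both runs have the same positions
    \<open>p\<close>, so the relation between two runs becomes a recurrence for one.\<close>
  have Suc: "p (Suc j) = Suc (p j)" if "2 * T + 1 \<le> j" "j + 2 * T + 3 \<le> k" for j
    using pos_packed_run_Suc[of k h "\<lambda>i. h (Suc i)" n T j A] that h(2) assms(5) by (simp add: p_def)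
  have lin: "p (2 * T + 1 + i) = p (2 * T + 1) + i" if "i + 4 * T + 3 \<le> k" for i
    using that by (induction i) (auto simp: Suc)
  have scen: "(\<lambda>a. a, h, \<lambda>t. (None, [0..<k])) \<in> scenarios n k"
    using h(1) assms(5) by (auto simp: scenarios_def valid_schedule_def strict_mono_imp_inj_on
        intro: inj_on_subset)
  \<comment> \<open>Agents meeting at round \<open>T\<close> start at most \<open>2 T\<close> apart,
    so a partner of \<open>?m\<close> lies between \<open>2 T + 1\<close> and
    \<open>6 T + 1\<close>, where \<open>lin\<close> applies.\<close>
  let ?m = "4 * T + 1"
  obtain b where b: "b < k" "b \<noteq> ?m" "p b = p ?m"
    using partially_gathered_meets[OF gathered_at_time_complexity[OF assms(1,2) scen] assms(3), of ?m]
      pos_packed_run_less[of ?m k n A h T] assms(5) kT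
    by (auto simp: p_def packed_run_def)
  have m: "p ?m \<in> {3 * T + 1..5 * T + 1}"
    using packed_run_interval[of k n T ?m A h] kT assms(5) by (simp add: p_def)
  obtain d where d: "\<bar>d\<bar> \<le> int T" "int (p b) = (int b + d) mod int n"
    using packed_run_offset[OF b(1) assms(5)] unfolding p_def by blast
  \<comment> \<open>The starting node is recovered from the final one: \<open>b\<close> could a
    priori be anywhere in the block, even across the wrap-around.\<close>
  have "(int b) mod int n = (int (p b) - d) mod int n" using d(2) by (simp add: mod_simps)
  moreover have "(int (p b) - d) mod int n = int (p b) - d"
    using d m b kT assms(5) by (intro mod_pos_pos_trivial) auto
  ultimately have "int b = int (p b) - d" using b assms(5) by simp
  then have bm: "2 * T + 1 \<le> b" "b \<le> 6 * T + 1" using m b d(1) by auto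
  have "p b = p (2 * T + 1) + (b - (2 * T + 1))" using lin[of "b - (2 * T + 1)"] bm kT by simp
  moreover have "p ?m = p (2 * T + 1) + 2 * T" using lin[of "2 * T"] kT by (simp add: algebra_simps)
  ultimately show False using b bm by simp
qed

theorem theorem2:
  shows "\<exists>c>0. \<exists>N. \<forall>n\<ge>N. \<forall>g k. \<forall>A :: (nat, nat) algorithm.
    1 < g \<and> g < k \<and> k \<le> n \<and> finite_automata A \<and> solves_partial_gathering g n k A \<longrightarrow>
    ereal (c * real n) \<le> ereal_of_enat (time_complexity n k A)"
proof (rule exI[of _ "1 / 20 :: real"], intro conjI exI[of _ "60 :: nat"] allI impI)
  fix n g k :: nat and A :: "(nat, nat) algorithm"
  assume n: "60 \<le> n"
    and "1 < g \<and> g < k \<and> k \<le> n \<and> finite_automata A \<and> solves_partial_gathering g n k A"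
  then have *: "1 < g" "g < k" "k \<le> n" "solves_partial_gathering g n k A" by auto
  show "ereal (1 / 20 * real n) \<le> ereal_of_enat (time_complexity n k A)"
  proof (cases "time_complexity n k A")
    case (enat T)
    \<comment> \<open>The second case gives \<open>n < 2 k \<le> 16 T + 10\<close>; since
      \<open>60 \<le> n\<close>, this forces \<open>T \<ge> 4\<close>, and \<open>4 T\<close>
      absorbs the constant.\<close>
    have "n \<le> 20 * T"
    proof (cases "2 * k \<le> n")
      case True
      then show ?thesis using time_bound_few_agents[OF *(4) enat *(1,2)] by simp
    next
      case False
      then show ?thesis using time_bound_many_agents[OF *(4) enat *(1-3)] n by simp
    qed
    then show ?thesis using enat by simp
  qed simp
qed simp

end
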